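(* Let $G$ be a finite connected multigraph with root $q$ and let $\Sigma$ be any tree growing sequence for $G$. Define $\tau:\mathcal{P}_{G,q}\to\mathcal{T}_G$ by $\tau(f)=T_f$ and $\rho$ on $\mathcal{P}_{G,q}$ by $\rho(f)=x^\alpha y^\beta$, the outputs of the TGS algorithm with $\Sigma$ applied to $f$. Then $\tau$ is a bijection from $\mathcal{P}_{G,q}$ to the set $\mathcal{T}_G$ of spanning trees of $G$, and $\rho$ is a bijection from $\mathcal{P}_{G,q}$ onto the multiset $\mathcal{M}_G$; that is, for every monomial $x^ay^b$, the number of $f\in\mathcal{P}_{G,q}$ with $\rho(f)=x^ay^b$ equals the coefficient of $x^ay^b$ in $T(G;x,y)$.
   Context: $G=(V,E)$ is a finite connected multigraph (loops and multiple edges allowed), $V=\{q,v_1,\dots,v_n\}$ with root $q$; parallel edges are given a fixed order. For $A\subseteq V\setminus\{q\}$ and $v\in A$, $outdeg_A(v)$ is the number of edges, with multiplicity, joining $v$ to vertices not in $A$. A $G$-parking function is $f:V\setminus\{q\}\to\mathbb{Z}_{\ge 0}$ such that every nonempty $A\subseteq V\setminus\{q\}$ contains $v$ with $0\le f(v)<outdeg_A(v)$; $\mathcal{P}_{G,q}$ is their set. $T(G;x,y)=\sum_{A\subseteq E}(x-1)^{c(A)-c(G)}(y-1)^{|A|+c(A)-|V|}$ is the Tutte polynomial ($c$ = number of components of the spanning subgraph); $\mathcal{M}_G$ is the multiset of its monomials counted with their coefficients. A rooted tree in $S\subseteq E$ is a tree subgraph containing $q$ with edges in $S$ (including $\{q\}$).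 A tree growing sequence $\Sigma=\{(S,\sigma_S)\}$ assigns to every $S\subseteq E$ and every rooted tree $T$ in $S$ an edge $\sigma_S(T)\in S\setminus E(T)$ with an endpoint in $V(T)$, whenever such an edge exists (and is undefined otherwise). The TGS algorithm applied to $f$ maintains $S$ (initially $E$), a tree $T=(U,X)$ (initially $(\{q\},\emptyset)$), integers $\alpha,\beta$ (initially $0$) and a working copy of $f$. While $e=\sigma_S(T)$ is defined, with $e_t\in U$ an endpoint and $e_h$ the other endpoint: if $e_h\in U$, remove $e$ from $S$ and increase $\beta$ by $1$; otherwise if $f(e_h)<0$ terminate; if $f(e_h)=0$, add $e$ to $X$ and $e_h$ to $U$, increasing $\alpha$ by $1$ if $e$ is a bridge of $(V,S)$; if $f(e_h)\ge1$, decrease $f(e_h)$ by $1$ and remove $e$ from $S$. Output: $T_f=(U,X)$ and $x^\alpha y^\beta$. *)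

theory Defs
  imports
    "HOL-Computational_Algebra.Polynomial"
    "HOL-Library.FuncSet"
    "HOL-Library.While_Combinator"
begin

section \<open>Multigraphs\<close>

text \<open>
  Edges are named objects, so parallel edges are distinct elements of \<open>edges G\<close> with the same
  set of endpoints.  A loop is an edge whose set of endpoints is a singleton.
\<close>

record ('v, 'e) multigraph =
  verts :: "'v set"
  edges :: "'e set"
  ends :: "'e \<Rightarrow> 'v set"

definition finite_multigraph :: "('v, 'e) multigraph \<Rightarrow> bool" where
  "finite_multigraph G \<longleftrightarrow>
     finite (verts G) \<and> finite (edges G) \<and>
     (\<forall>e\<in>edges G. \<exists>u\<in>verts G. \<exists>v\<in>verts G. ends G e = {u, v})"

definition adjacency :: "('v, 'e) multigraph \<Rightarrow> 'v rel" where
  "adjacency G = {(u, v) \<in> verts G \<times> verts G. \<exists>e\<in>edges G. ends G e = {u, v}}"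

definition reachability :: "('v, 'e) multigraph \<Rightarrow> 'v rel" where
  "reachability G = (adjacency G)\<^sup>* \<inter> verts G \<times> verts G"

definition connected_graph :: "('v, 'e) multigraph \<Rightarrow> bool" where
  "connected_graph G \<longleftrightarrow>
     verts G \<noteq> {} \<and> (\<forall>u\<in>verts G. \<forall>v\<in>verts G. (u, v) \<in> reachability G)"

definition num_components :: "('v, 'e) multigraph \<Rightarrow> nat" where
  "num_components G = card (verts G // reachability G)"

definition spanning_subgraph :: "('v, 'e) multigraph \<Rightarrow> 'e set \<Rightarrow> ('v, 'e) multigraph" where
  "spanning_subgraph G A = G\<lparr>edges := A\<rparr>"

definition bridge :: "('v, 'e) multigraph \<Rightarrow> 'e \<Rightarrow> bool" where
  "bridge G e \<longleftrightarrow>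
     e \<in> edges G \<and> num_components (spanning_subgraph G (edges G - {e})) > num_components G"

text \<open>
  The cycle visits \<open>vs ! 0, vs ! 1, \<dots>\<close> and returns to \<open>vs ! 0\<close>, using \<open>es ! i\<close> to leave \<open>vs ! i\<close>.
  Cycles of length 1 are loops and cycles of length 2 are pairs of parallel edges.
\<close>

definition is_cycle :: "('v, 'e) multigraph \<Rightarrow> 'v list \<Rightarrow> 'e list \<Rightarrow> bool" where
  "is_cycle G vs es \<longleftrightarrow>
     es \<noteq> [] \<and> length vs = length es \<and> distinct vs \<and> distinct es \<and>
     set vs \<subseteq> verts G \<and> set es \<subseteq> edges G \<and>
     (\<forall>i<length es. ends G (es ! i) = {vs ! i, vs ! (Suc i mod length es)})"

definition is_tree :: "('v, 'e) multigraph \<Rightarrow> bool" where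
  "is_tree G \<longleftrightarrow> finite_multigraph G \<and> connected_graph G \<and> (\<nexists>vs es. is_cycle G vs es)"

text \<open>
  Subgraphs of \<open>G\<close> are represented by pairs of a vertex set and an edge set.
\<close>

definition tree_subgraph :: "('v, 'e) multigraph \<Rightarrow> 'v set \<times> 'e set \<Rightarrow> bool" where
  "tree_subgraph G = (\<lambda>(U, X).
     U \<subseteq> verts G \<and> X \<subseteq> edges G \<and> is_tree (G\<lparr>verts := U, edges := X\<rparr>))"

definition spanning_trees :: "('v, 'e) multigraph \<Rightarrow> ('v set \<times> 'e set) set" where
  "spanning_trees G = {T. tree_subgraph G T \<and> fst T = verts G}"


section \<open>Parking functions\<close>

definition outdeg :: "('v, 'e) multigraph \<Rightarrow> 'v set \<Rightarrow> 'v \<Rightarrow> nat" where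
  "outdeg G A v = card {e \<in> edges G. \<exists>w\<in>verts G - A. ends G e = {v, w}}"

text \<open>
  Functions on \<open>verts G - {q}\<close> are extensional, so that each of them has exactly one representative.
\<close>

definition parking_functions :: "('v, 'e) multigraph \<Rightarrow> 'v \<Rightarrow> ('v \<Rightarrow> int) set" where
  "parking_functions G q =
     {f \<in> (verts G - {q}) \<rightarrow>\<^sub>E {0..}.
        \<forall>A. A \<subseteq> verts G - {q} \<and> A \<noteq> {} \<longrightarrow> (\<exists>v\<in>A. 0 \<le> f v \<and> f v < int (outdeg G A v))}"


section \<open>The Tutte polynomial\<close>

text \<open>
  A polynomial in \<open>x\<close> and \<open>y\<close> is a polynomial in \<open>x\<close> whose coefficients are polynomials in \<open>y\<close>.
\<close>

definition varx :: "int poly poly" where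
  "varx = [:0, 1:]"

definition vary :: "int poly poly" where
  "vary = [:[:0, 1:]:]"

definition coeff_xy :: "int poly poly \<Rightarrow> nat \<Rightarrow> nat \<Rightarrow> int" where
  "coeff_xy p a b = coeff (coeff p a) b"

text \<open>
  The subtractions in the exponents do not truncate:
  \<open>c(A) \<ge> c(G)\<close> and \<open>|A| + c(A) \<ge> |V|\<close> for every \<open>A \<subseteq> E\<close>.
\<close>

definition tutte_poly :: "('v, 'e) multigraph \<Rightarrow> int poly poly" where
  "tutte_poly G =
     (\<Sum>A\<in>Pow (edges G).
        (varx - 1) ^ (num_components (spanning_subgraph G A) - num_components G) *
        (vary - 1) ^ (card A + num_components (spanning_subgraph G A) - card (verts G)))"


section \<open>Tree growing sequences and the TGS algorithm\<close>

definition rooted_tree ::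
    "('v, 'e) multigraph \<Rightarrow> 'v \<Rightarrow> 'e set \<Rightarrow> 'v set \<times> 'e set \<Rightarrow> bool" where
  "rooted_tree G q S T \<longleftrightarrow> tree_subgraph G T \<and> q \<in> fst T \<and> snd T \<subseteq> S"

definition candidate_edges ::
    "('v, 'e) multigraph \<Rightarrow> 'e set \<Rightarrow> 'v set \<times> 'e set \<Rightarrow> 'e set" where
  "candidate_edges G S T = {e \<in> S - snd T. ends G e \<inter> fst T \<noteq> {}}"

text \<open>
  \<open>None\<close> stands for undefinedness; values outside the pairs of some \<open>S \<subseteq> E\<close> and a rooted
  tree in \<open>S\<close> are irrelevant.
\<close>

type_synonym ('v, 'e) edge_choice = "'e set \<Rightarrow> 'v set \<times> 'e set \<Rightarrow> 'e option"

definition tree_growing_sequence ::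
    "('v, 'e) multigraph \<Rightarrow> 'v \<Rightarrow> ('v, 'e) edge_choice \<Rightarrow> bool" where
  "tree_growing_sequence G q \<sigma> \<longleftrightarrow>
     (\<forall>S T. S \<subseteq> edges G \<and> rooted_tree G q S T \<longrightarrow>
        (if candidate_edges G S T = {} then \<sigma> S T = None
         else \<exists>e\<in>candidate_edges G S T. \<sigma> S T = Some e))"

record ('v, 'e) tgs_state =
  avail :: "'e set"
  tverts :: "'v set"
  tedges :: "'e set"
  alpha :: nat
  beta :: nat
  cur :: "'v \<Rightarrow> int"

text \<open>
  \<open>other_end G e u\<close> is the second endpoint of an edge \<open>e\<close> at \<open>u\<close>; it is \<open>u\<close> itself if \<open>e\<close> is a loop.
  The choice of \<open>e\<^sub>t\<close> in \<open>head\<close> is immaterial: if it is not unique, then both endpoints lie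
  in \<open>U\<close>, and the algorithm only tests whether \<open>e\<^sub>h \<in> U\<close>.
\<close>

definition other_end :: "('v, 'e) multigraph \<Rightarrow> 'e \<Rightarrow> 'v \<Rightarrow> 'v" where
  "other_end G e u = (THE w. ends G e = {u, w})"

definition head :: "('v, 'e) multigraph \<Rightarrow> 'v set \<Rightarrow> 'e \<Rightarrow> 'v" where
  "head G U e = other_end G e (SOME u. u \<in> ends G e \<and> u \<in> U)"

definition tgs_init :: "('v, 'e) multigraph \<Rightarrow> 'v \<Rightarrow> ('v \<Rightarrow> int) \<Rightarrow> ('v, 'e) tgs_state" where
  "tgs_init G q f =
     \<lparr>avail = edges G, tverts = {q}, tedges = {}, alpha = 0, beta = 0, cur = f\<rparr>"

definition tgs_choice :: "('v, 'e) edge_choice \<Rightarrow> ('v, 'e) tgs_state \<Rightarrow> 'e option" where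
  "tgs_choice \<sigma> s = \<sigma> (avail s) (tverts s, tedges s)"

definition tgs_continue ::
    "('v, 'e) multigraph \<Rightarrow> ('v, 'e) edge_choice \<Rightarrow> ('v, 'e) tgs_state \<Rightarrow> bool" where
  "tgs_continue G \<sigma> s =
     (case tgs_choice \<sigma> s of
        None \<Rightarrow> False
      | Some e \<Rightarrow> \<not> (head G (tverts s) e \<notin> tverts s \<and> cur s (head G (tverts s) e) < 0))"

definition tgs_step ::
    "('v, 'e) multigraph \<Rightarrow> ('v, 'e) edge_choice \<Rightarrow> ('v, 'e) tgs_state \<Rightarrow> ('v, 'e) tgs_state" where
  "tgs_step G \<sigma> s =
     (let e = the (tgs_choice \<sigma> s); h = head G (tverts s) e in
      if h \<in> tverts s then
        s\<lparr>avail := avail s - {e}, beta := beta s + 1\<rparr>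
      else if cur s h = 0 then
        s\<lparr>tedges := insert e (tedges s), tverts := insert h (tverts s),
          alpha := (if bridge (spanning_subgraph G (avail s)) e then alpha s + 1 else alpha s)\<rparr>
      else
        s\<lparr>cur := (cur s)(h := cur s h - 1), avail := avail s - {e}\<rparr>)"

definition tgs ::
    "('v, 'e) multigraph \<Rightarrow> 'v \<Rightarrow> ('v, 'e) edge_choice \<Rightarrow> ('v \<Rightarrow> int) \<Rightarrow> ('v, 'e) tgs_state" where
  "tgs G q \<sigma> f = while (tgs_continue G \<sigma>) (tgs_step G \<sigma>) (tgs_init G q f)"

definition tgs_tree ::
    "('v, 'e) multigraph \<Rightarrow> 'v \<Rightarrow> ('v, 'e) edge_choice \<Rightarrow> ('v \<Rightarrow> int) \<Rightarrow> 'v set \<times> 'e set" where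
  "tgs_tree G q \<sigma> f = (tverts (tgs G q \<sigma> f), tedges (tgs G q \<sigma> f))"

definition tgs_monomial ::
    "('v, 'e) multigraph \<Rightarrow> 'v \<Rightarrow> ('v, 'e) edge_choice \<Rightarrow> ('v \<Rightarrow> int) \<Rightarrow> int poly poly" where
  "tgs_monomial G q \<sigma> f = varx ^ alpha (tgs G q \<sigma> f) * vary ^ beta (tgs G q \<sigma> f)"

end

theory Submission
  imports Defs
begin

section \<open>Components of spanning subgraphs\<close>

text \<open>The algorithm carries out a deletion-contraction recursion. A state with available edges
  S and tree (U,X) stands for the minor in which X is contracted and the edges outside S are
  deleted. Three objects live on it: the parking functions relative to the state, the spanning trees
  Y with X \<subseteq> Y \<subseteq> S, and the sum of the Tutte summands over {X..S}. The edge e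
  chosen by \<sigma> lies in S - X and meets U, and it acts on all three in the same way.

  If both ends of e are in U, then e is a loop of the minor: no tree between X and S contains it,
  the parking condition does not see it, and the sum acquires the factor y that \<open>beta\<close>
  records (\<open>sum_tutte_weight_loop\<close>). If the other end h is outside U, then f(h) = 0
  means that e is contracted (\<open>parking_from_zero\<close>), and f(h) > 0 means that e is
  deleted, the decrease of f(h) compensating for the lost edge
  (\<open>parking_from_positive\<close>). If e is a bridge of S, the deletion side is empty for
  trees and for parking functions (\<open>parking_from_connected\<close>), and the sum acquires the
  factor x that \<open>alpha\<close> records (\<open>sum_tutte_weight_bridge\<close>). When no edge
  is left to choose, exactly one parking function and one tree remain, and the sum is 1.

  Induction on |S - X| (\<open>tgs_run_enumerates_trees\<close>) gives the bijection with trees and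
  shows that the output monomials add up to the Tutte polynomial. Comparing coefficients turns the
  sum into the count for each monomial.\<close>

lemma spanning_subgraph_simps [simp]:
  "verts (spanning_subgraph G A) = verts G"
  "edges (spanning_subgraph G A) = A"
  "ends (spanning_subgraph G A) = ends G"
  "spanning_subgraph (spanning_subgraph G A) B = spanning_subgraph G B"
  "spanning_subgraph G (edges G) = G"
  by (simp_all add: spanning_subgraph_def)

lemma sym_adjacency: "sym (adjacency G)"
  by (auto simp: adjacency_def sym_def insert_commute)

lemma equiv_reachability: "equiv (verts G) (reachability G)"
proof (rule equivI)
  show "reachability G \<subseteq> verts G \<times> verts G"
    by (auto simp: reachability_def)
  show "refl_on (verts G) (reachability G)"
    by (auto simp: reachability_def refl_on_def)
  show "sym (reachability G)"
    using symD[OF sym_rtrancl[OF sym_adjacency]] by (auto simp: reachability_def intro!: symI)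
  show "trans (reachability G)"
    by (auto simp: reachability_def trans_def)
qed

lemma reachability_mono:
  assumes "A \<subseteq> B"
  shows "reachability (spanning_subgraph G A) \<subseteq> reachability (spanning_subgraph G B)"
proof -
  have "adjacency (spanning_subgraph G A) \<subseteq> adjacency (spanning_subgraph G B)"
    using assms by (auto simp: adjacency_def)
  from rtrancl_mono[OF this] show ?thesis
    by (auto simp: reachability_def)
qed

text \<open>Crossing \<open>e\<close> more than once gains nothing: a second crossing leads back
  into the class where the path started. The induction along a path keeps track of whether the path
  has stayed in its old class or has changed sides.\<close>

lemma reachability_insert:
  fixes G :: "('v, 'e) multigraph" and A :: "'e set"
  assumes e: "ends G e = {u, w}" and uw: "u \<in> verts G" "w \<in> verts G"
  defines "R \<equiv> reachability (spanning_subgraph G A)"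
  shows "reachability (spanning_subgraph G (insert e A)) =
    R \<union> R `` {u} \<times> R `` {w} \<union> R `` {w} \<times> R `` {u}" (is "?R' = ?Q")
proof
  have eqR: "equiv (verts G) R"
    using equiv_reachability[of "spanning_subgraph G A"] by (simp add: R_def)
  have eqR': "equiv (verts G) ?R'"
    using equiv_reachability[of "spanning_subgraph G (insert e A)"] by simp
  have symR: "(x, y) \<in> R \<Longrightarrow> (y, x) \<in> R" for x y
    using eqR by (meson equivE symD)
  have transR: "(x, y) \<in> R \<Longrightarrow> (y, z) \<in> R \<Longrightarrow> (x, z) \<in> R" for x y z
    using eqR by (meson equivE transD)
  have reflR: "x \<in> verts G \<Longrightarrow> (x, x) \<in> R" for x
    using eqR by (meson equivE refl_onD)
  have inV: "(x, y) \<in> R \<Longrightarrow> x \<in> verts G \<and> y \<in> verts G" for x y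
    by (auto simp: R_def reachability_def)
  have symR': "(x, y) \<in> ?R' \<Longrightarrow> (y, x) \<in> ?R'" for x y
    using eqR' by (meson equivE symD)
  have transR': "(x, y) \<in> ?R' \<Longrightarrow> (y, z) \<in> ?R' \<Longrightarrow> (x, z) \<in> ?R'" for x y z
    using eqR' by (meson equivE transD)
  have sub: "R \<subseteq> ?R'"
    unfolding R_def by (intro reachability_mono) auto
  have "(u, w) \<in> adjacency (spanning_subgraph G (insert e A))"
    using e uw by (auto simp: adjacency_def)
  then have "(u, w) \<in> ?R'"
    using uw by (auto simp: reachability_def)
  then have "(x, y) \<in> ?R'" "(y, x) \<in> ?R'" if "(u, x) \<in> R" "(w, y) \<in> R" for x y
    using that symR' transR' subsetD[OF sub] by metis+
  then show "?Q \<subseteq> ?R'"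
    using sub by auto
  have new_step: "(y, z) \<in> R \<or> (y = u \<and> z = w) \<or> (y = w \<and> z = u)"
    if "(y, z) \<in> adjacency (spanning_subgraph G (insert e A))" for y z
  proof -
    from that have V: "y \<in> verts G" "z \<in> verts G" and
      "(y, z) \<in> adjacency (spanning_subgraph G A) \<or> ends G e = {y, z}"
      by (auto simp: adjacency_def)
    then show ?thesis
      using e by (auto simp: R_def reachability_def doubleton_eq_iff)
  qed
  have "(x, y) \<in> ?Q" if "(x, y) \<in> (adjacency (spanning_subgraph G (insert e A)))\<^sup>*" "x \<in> verts G" for x y
    using that
  proof (induction rule: rtrancl_induct)
    case base
    then show ?case using reflR by blast
  next
    case (step y z)
    have refl: "(u, u) \<in> R" "(w, w) \<in> R" using reflR uw by auto
    consider "(x, y) \<in> R" | "(u, x) \<in> R" "(w, y) \<in> R" | "(w, x) \<in> R" "(u, y) \<in> R"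
      using step(3)[OF step(4)] by blast
    then show ?case
    proof cases
      case 1
      then show ?thesis using new_step[OF step(2)] refl symR[OF 1] transR[OF 1] by auto
    next
      case 2
      then show ?thesis using new_step[OF step(2)] refl symR[OF 2(1)] transR[OF 2(2)] transR[of x u z]
        by auto
    next
      case 3
      then show ?thesis using new_step[OF step(2)] refl symR[OF 3(1)] transR[OF 3(2)] transR[of x w z]
        by auto
    qed
  qed
  then show "?R' \<subseteq> ?Q"
    by (auto simp: reachability_def)
qed

lemma reachability_insert_reachable:
  assumes "ends G e = {u, w}" and "(u, w) \<in> reachability (spanning_subgraph G A)"
  shows "reachability (spanning_subgraph G (insert e A)) = reachability (spanning_subgraph G A)"
proof -
  let ?R = "reachability (spanning_subgraph G A)"
  have V: "u \<in> verts G" "w \<in> verts G"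
    using assms(2) by (auto simp: reachability_def)
  have "equiv (verts G) ?R"
    using equiv_reachability[of "spanning_subgraph G A"] by simp
  then have symR: "sym ?R" and transR: "trans ?R"
    by (auto simp: equiv_def)
  have "?R `` {u} \<times> ?R `` {w} \<subseteq> ?R"
    using assms(2) symD[OF symR] transD[OF transR] by blast
  moreover have "?R `` {w} \<times> ?R `` {u} \<subseteq> ?R"
    using assms(2) symD[OF symR] transD[OF transR] by blast
  ultimately show ?thesis
    unfolding reachability_insert[OF assms(1) V] by blast
qed

lemma num_components_insert_reachable:
  assumes "ends G e = {u, w}" and "(u, w) \<in> reachability (spanning_subgraph G A)"
  shows "num_components (spanning_subgraph G (insert e A)) = num_components (spanning_subgraph G A)"
  using reachability_insert_reachable[OF assms] by (simp add: num_components_def)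

text \<open>The quotient loses the two distinct classes of \<open>u\<close> and \<open>w\<close> and
  gains their union \<open>B\<close>, which was not a class before.\<close>

lemma num_components_insert_unreachable:
  assumes fin: "finite (verts G)" and e: "ends G e = {u, w}" and V: "u \<in> verts G" "w \<in> verts G"
    and nr: "(u, w) \<notin> reachability (spanning_subgraph G A)"
  shows "num_components (spanning_subgraph G A) =
    Suc (num_components (spanning_subgraph G (insert e A)))"
proof -
  define R where "R = reachability (spanning_subgraph G A)"
  define Q where "Q = R \<union> R `` {u} \<times> R `` {w} \<union> R `` {w} \<times> R `` {u}"
  have Q: "reachability (spanning_subgraph G (insert e A)) = Q"
    using reachability_insert[OF e V] by (simp add: Q_def R_def)
  have eqR: "equiv (verts G) R"
    using equiv_reachability[of "spanning_subgraph G A"] by (simp add: R_def)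
  have symR: "(x, y) \<in> R \<Longrightarrow> (y, x) \<in> R" for x y
    using eqR by (meson equivE symD)
  have transR: "(x, y) \<in> R \<Longrightarrow> (y, z) \<in> R \<Longrightarrow> (x, z) \<in> R" for x y z
    using eqR by (meson equivE transD)
  have reflR: "x \<in> verts G \<Longrightarrow> (x, x) \<in> R" for x
    using eqR by (meson equivE refl_onD)
  have nR: "(u, w) \<notin> R" "(w, u) \<notin> R"
    using nr symR by (auto simp: R_def)
  define B where "B = R `` {u} \<union> R `` {w}"
  let ?P = "verts G // R"
  have QB: "Q `` {x} = B" if "x \<in> B" for x
    using that symR transR nR unfolding Q_def B_def by blast
  have QR: "Q `` {x} = R `` {x}" if "x \<notin> B" for x
    using that symR unfolding Q_def B_def by blast
  have RB: "R `` {x} = R `` {u} \<or> R `` {x} = R `` {w} \<longleftrightarrow> x \<in> B" if "x \<in> verts G" for x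
    using that reflR[OF that] symR transR unfolding B_def by blast
  have uB: "u \<in> B" using reflR V by (auto simp: B_def)
  have eq: "verts G // Q = insert B (?P - {R `` {u}, R `` {w}})"
  proof (intro set_eqI iffI)
    fix C assume "C \<in> verts G // Q"
    then obtain x where x: "x \<in> verts G" "C = Q `` {x}" by (auto elim: quotientE)
    show "C \<in> insert B (?P - {R `` {u}, R `` {w}})"
    proof (cases "x \<in> B")
      case True
      then show ?thesis using x QB by simp
    next
      case False
      then show ?thesis using x QR RB by (auto intro: quotientI)
    qed
  next
    fix C assume "C \<in> insert B (?P - {R `` {u}, R `` {w}})"
    then consider "C = B" | "C \<in> ?P" "C \<noteq> R `` {u}" "C \<noteq> R `` {w}" by blast
    then show "C \<in> verts G // Q"
    proof cases
      case 1
      then show ?thesis using QB[OF uB] quotientI[OF V(1), of Q] by simp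
    next
      case 2
      then obtain x where x: "x \<in> verts G" "C = R `` {x}" by (auto elim: quotientE)
      then have "x \<notin> B" using 2 RB by auto
      then show ?thesis using x QR quotientI[of x "verts G" Q] by simp
    qed
  qed
  have "B \<notin> ?P"
  proof
    assume "B \<in> ?P"
    then obtain x where "B = R `` {x}" by (auto elim: quotientE)
    then have "(x, u) \<in> R" "(x, w) \<in> R" using reflR V by (auto simp: B_def)
    then show False using nR symR transR by blast
  qed
  moreover have finP: "finite ?P"
    using finite_quotient[OF fin] eqR by (auto simp: equiv_def)
  moreover have uP: "R `` {u} \<in> ?P" and wP: "R `` {w} \<in> ?P"
    using V by (auto intro: quotientI)
  moreover have "R `` {u} \<noteq> R `` {w}"
    using nR reflR V by blast
  moreover have "card ?P = Suc (Suc (card (?P - {R `` {u}, R `` {w}})))"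
  proof -
    have "card {R `` {u}, R `` {w}} = 2" using \<open>R `` {u} \<noteq> R `` {w}\<close> by simp
    moreover have "card {R `` {u}, R `` {w}} \<le> card ?P"
      using finP uP wP by (intro card_mono) auto
    ultimately show ?thesis
      using finP uP wP by (simp add: card_Diff_subset)
  qed
  ultimately show ?thesis
    by (simp add: num_components_def Q R_def[symmetric] eq)
qed

lemma num_components_connected:
  assumes "connected_graph G"
  shows "num_components G = 1"
proof -
  have "reachability G = verts G \<times> verts G"
    using assms by (auto simp: connected_graph_def reachability_def)
  moreover have "verts G \<noteq> {}"
    using assms by (simp add: connected_graph_def)
  ultimately have "verts G // reachability G = {verts G}"
    by (auto simp: quotient_def)
  then show ?thesis by (simp add: num_components_def)
qed

lemma num_components_pos:
  assumes "finite (verts G)" "verts G \<noteq> {}"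
  shows "num_components G > 0"
proof -
  have "finite (verts G // reachability G)"
    using finite_quotient[OF assms(1)] equiv_reachability[of G] by (auto simp: equiv_def)
  moreover have "verts G // reachability G \<noteq> {}"
    using assms(2) by (auto simp: quotient_def)
  ultimately show ?thesis by (simp add: num_components_def card_gt_0_iff)
qed

text \<open>Without edges there are |V| components, and each edge lowers their number by at most
  one. This keeps the exponent of y - 1 from truncating.\<close>

lemma card_verts_le:
  assumes G: "finite_multigraph G" and A: "A \<subseteq> edges G"
  shows "card (verts G) \<le> card A + num_components (spanning_subgraph G A)"
proof -
  have fV: "finite (verts G)" using G by (simp add: finite_multigraph_def)
  have "finite A" using G A by (auto simp: finite_multigraph_def intro: finite_subset)
  then show ?thesis using A
  proof (induction A)
    case empty
    have "adjacency (spanning_subgraph G {}) = {}" by (auto simp: adjacency_def)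
    then have "reachability (spanning_subgraph G {}) = Id_on (verts G)"
      by (auto simp: reachability_def)
    then have "verts G // reachability (spanning_subgraph G {}) = (\<lambda>v. {v}) ` verts G"
      by (auto simp: quotient_def)
    then show ?case by (simp add: num_components_def card_image)
  next
    case (insert e A)
    then obtain u w where e: "ends G e = {u, w}" "u \<in> verts G" "w \<in> verts G"
      using G by (auto simp: finite_multigraph_def)
    show ?case
      using insert.IH insert.hyps insert.prems num_components_insert_reachable[OF e(1), of A]
        num_components_insert_unreachable[OF fV e, of A]
      by (cases "(u, w) \<in> reachability (spanning_subgraph G A)") simp_all
  qed
qed

lemma finite_multigraph_ends:
  assumes "finite_multigraph G" "e \<in> edges G"
  shows "ends G e \<subseteq> verts G" "ends G e \<noteq> {}"
  using assms by (auto simp: finite_multigraph_def)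

section \<open>Cycles and trees\<close>

text \<open>A walk is made simple as it grows: a step to a fresh vertex extends the path, and a step
  to a visited vertex cuts the path back to that visit.\<close>

lemma simple_path_exists:
  assumes "(u, w) \<in> (adjacency G)\<^sup>*" "u \<in> verts G"
  shows "\<exists>vs es. length vs = Suc (length es) \<and> distinct vs \<and> set vs \<subseteq> verts G \<and>
    set es \<subseteq> edges G \<and> vs ! 0 = u \<and> vs ! length es = w \<and>
    (\<forall>i<length es. ends G (es ! i) = {vs ! i, vs ! Suc i})"
  using assms
proof (induction rule: rtrancl_induct)
  case base
  then show ?case by (intro exI[of _ "[u]"] exI[of _ "[]"]) auto
next
  case (step y z)
  then obtain vs es where p: "length vs = Suc (length es)" "distinct vs" "set vs \<subseteq> verts G"
    "set es \<subseteq> edges G" "vs ! 0 = u" "vs ! length es = y"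
    "\<forall>i<length es. ends G (es ! i) = {vs ! i, vs ! Suc i}"
    by blast
  from step(2) obtain e where e: "e \<in> edges G" "ends G e = {y, z}" "z \<in> verts G"
    by (auto simp: adjacency_def)
  show ?case
  proof (cases "z \<in> set vs")
    case True
    then obtain k where k: "k < length vs" "vs ! k = z" by (auto simp: in_set_conv_nth)
    have "min (length es) k = k" using k p(1) by simp
    then show ?thesis
      using p k set_take_subset[of "Suc k" vs] set_take_subset[of k es]
      by (intro exI[of _ "take (Suc k) vs"] exI[of _ "take k es"]) auto
  next
    case False
    then show ?thesis
      using p e by (intro exI[of _ "vs @ [z]"] exI[of _ "es @ [e]"])
        (auto simp: nth_append less_Suc_eq)
  qed
qed

text \<open>A simple path from \<open>u\<close> to \<open>w\<close> avoiding \<open>e\<close> is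
  closed up by \<open>e\<close>. If \<open>e\<close> is a loop, the path has no edges and the cycle
  has length 1.\<close>

lemma reachable_imp_cycle:
  assumes e: "e \<in> Y" "ends G e = {u, w}"
    and r: "(u, w) \<in> reachability (spanning_subgraph G (Y - {e}))"
  shows "\<exists>vs es. is_cycle (spanning_subgraph G Y) vs es"
proof -
  let ?H = "spanning_subgraph G (Y - {e})"
  obtain vs es where p: "length vs = Suc (length es)" "distinct vs" "set vs \<subseteq> verts G"
    "set es \<subseteq> Y - {e}" "vs ! 0 = u" "vs ! length es = w"
    and ed: "\<forall>i<length es. ends G (es ! i) = {vs ! i, vs ! Suc i}"
    using simple_path_exists[of u w ?H] r by (auto simp: reachability_def)
  \<comment> \<open>A repeated edge would join two different pairs of consecutive vertices, which
    distinctness of \<open>vs\<close> excludes.\<close>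
  have "distinct es"
    unfolding distinct_conv_nth
  proof (intro allI impI notI)
    fix i j assume ij: "i < length es" "j < length es" "i \<noteq> j" "es ! i = es ! j"
    then have "{vs ! i, vs ! Suc i} = {vs ! j, vs ! Suc j}"
      using ed by metis
    then show False
      using ij p(1,2) by (auto simp: doubleton_eq_iff nth_eq_iff_index_eq)
  qed
  moreover have "Suc i mod Suc (length es) = Suc i" if "i < length es" for i
    using that by simp
  ultimately have "is_cycle (spanning_subgraph G Y) vs (es @ [e])"
    using p e ed by (auto simp: is_cycle_def nth_append less_Suc_eq insert_commute)
  then show ?thesis by blast
qed

text \<open>The cycle enters and leaves \<open>h\<close> by the same edge \<open>e\<close>. As its
  edges are distinct, it has length 1 and \<open>e\<close> is a loop.\<close>

lemma is_cycle_not_leaf: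
  assumes c: "is_cycle G vs es" and "h \<in> set vs"
    and leaf: "\<And>e'. e' \<in> edges G \<Longrightarrow> h \<in> ends G e' \<Longrightarrow> e' = e"
  shows "ends G e = {h}"
proof -
  obtain j where j: "j < length es" "vs ! j = h"
    using assms by (auto simp: is_cycle_def in_set_conv_nth)
  define n where "n = length es"
  have ed: "ends G (es ! i) = {vs ! i, vs ! (Suc i mod n)}" and inE: "es ! i \<in> edges G"
    if "i < n" for i
    using c that by (auto simp: is_cycle_def n_def)
  have dist: "distinct es" using c by (simp add: is_cycle_def)
  \<comment> \<open>\<open>k\<close> is the cyclic predecessor of \<open>j\<close>, so
    \<open>es ! k\<close> is the edge by which the cycle enters \<open>h\<close>.\<close>
  define k where "k = (if j = 0 then n - 1 else j - 1)"
  have k: "k < n" "Suc k mod n = j"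
    using j by (auto simp: k_def n_def)
  have "es ! j = e" "es ! k = e"
    using leaf ed[of j] ed[of k] inE[of j] inE[of k] j k by (auto simp: n_def)
  then have "j = k"
    using dist j k by (auto simp: nth_eq_iff_index_eq n_def)
  then show ?thesis
    using ed[of j] j k \<open>es ! j = e\<close> by (simp add: n_def)
qed

text \<open>In the larger graph \<open>h\<close> meets only \<open>e\<close>, which is not a loop. A
  cycle therefore misses \<open>h\<close>, hence also \<open>e\<close>, and already lies in the old
  tree.\<close>

lemma is_tree_insert_leaf:
  assumes t: "is_tree (G\<lparr>verts := U, edges := X\<rparr>)" and e: "ends G e = {u, h}"
    and uh: "u \<in> U" "h \<notin> U"
  shows "is_tree (G\<lparr>verts := insert h U, edges := insert e X\<rparr>)"
proof -
  let ?H = "G\<lparr>verts := U, edges := X\<rparr>"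
  let ?K = "G\<lparr>verts := insert h U, edges := insert e X\<rparr>"
  have fin: "finite_multigraph ?H" and con: "connected_graph ?H" and
    nc: "\<not> is_cycle ?H vs es" for vs es
    using t by (auto simp: is_tree_def)
  have endsX: "ends G e' \<subseteq> U" if "e' \<in> X" for e'
    using finite_multigraph_ends[OF fin, of e'] that by simp
  have "finite_multigraph ?K"
    unfolding finite_multigraph_def
  proof (intro conjI ballI)
    fix e' assume "e' \<in> edges ?K"
    then consider "e' = e" | "e' \<in> X" by auto
    then show "\<exists>a\<in>verts ?K. \<exists>b\<in>verts ?K. ends ?K e' = {a, b}"
    proof cases
      case 1
      then show ?thesis using e uh by auto
    next
      case 2
      then show ?thesis using fin by (auto simp: finite_multigraph_def)
    qed
  qed (use fin in \<open>auto simp: finite_multigraph_def\<close>)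
  moreover have "connected_graph ?K"
  proof -
    have eqK: "equiv (insert h U) (reachability ?K)"
      using equiv_reachability[of ?K] by simp
    have "adjacency ?H \<subseteq> adjacency ?K" by (auto simp: adjacency_def)
    from rtrancl_mono[OF this] have sub: "reachability ?H \<subseteq> reachability ?K"
      by (auto simp: reachability_def)
    have "(u, h) \<in> adjacency ?K" using e uh by (auto simp: adjacency_def)
    then have uhK: "(u, h) \<in> reachability ?K" using uh by (auto simp: reachability_def)
    have "(u, v) \<in> reachability ?K" if "v \<in> insert h U" for v
      using that uhK sub con uh by (auto simp: connected_graph_def)
    moreover have "sym (reachability ?K)" "trans (reachability ?K)"
      using eqK by (simp_all add: equiv_def)
    ultimately have "(v, w) \<in> reachability ?K" if "v \<in> insert h U" "w \<in> insert h U" for v w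
      using that symD[of "reachability ?K" u v] transD[of "reachability ?K" v u w] by blast
    then show ?thesis
      by (simp add: connected_graph_def)
  qed
  moreover have "\<not> is_cycle ?K vs es" for vs es
  proof
    assume c: "is_cycle ?K vs es"
    have "h \<notin> set vs"
    proof
      assume "h \<in> set vs"
      from is_cycle_not_leaf[OF c this, of e] have "ends G e = {h}"
        using endsX uh by auto
      then show False using e uh by auto
    qed
    moreover have "e \<notin> set es"
    proof
      assume "e \<in> set es"
      then obtain i where "i < length es" "es ! i = e" by (auto simp: in_set_conv_nth)
      with c e have "{u, h} = {vs ! i, vs ! (Suc i mod length es)}" "i < length vs"
        "Suc i mod length es < length vs"
        by (auto simp: is_cycle_def)
      then have "h \<in> set vs" by (metis insertCI insertE nth_mem singletonD)
      with \<open>h \<notin> set vs\<close> show False ..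
    qed
    ultimately have "is_cycle ?H vs es"
      using c by (auto simp: is_cycle_def)
    then show False using nc by blast
  qed
  ultimately show ?thesis by (auto simp: is_tree_def)
qed


text \<open>Plays the role of the spanning trees of the minor with \<open>X\<close> contracted and
  everything outside \<open>S\<close> deleted. Working with the interval \<open>{X..S}\<close>
  avoids constructing that minor.\<close>

definition tree_edges_between :: "('v, 'e) multigraph \<Rightarrow> 'e set \<Rightarrow> 'e set \<Rightarrow> 'e set set" where
  "tree_edges_between G X S = {Y \<in> {X..S}. is_tree (spanning_subgraph G Y)}"

lemma spanning_trees_eq:
  "spanning_trees G = Pair (verts G) ` tree_edges_between G {} (edges G)"
proof -
  have iff: "(U, Y) \<in> spanning_trees G \<longleftrightarrow> U = verts G \<and> Y \<in> tree_edges_between G {} (edges G)" for U Y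
    unfolding spanning_trees_def tree_subgraph_def tree_edges_between_def
    by (cases "U = verts G") (simp_all add: spanning_subgraph_def)
  show ?thesis
  proof (intro set_eqI)
    fix T show "T \<in> spanning_trees G \<longleftrightarrow> T \<in> Pair (verts G) ` tree_edges_between G {} (edges G)"
      by (cases T) (simp only: iff image_iff prod.inject, blast)
  qed
qed

lemma atLeastAtMost_split:
  assumes "e \<in> S" "e \<notin> X"
  shows "{X..S} = {X..S - {e}} \<union> {insert e X..S}" "{X..S - {e}} \<inter> {insert e X..S} = {}"
  using assms by auto

lemma bij_betw_insert_atLeastAtMost:
  assumes "e \<in> S" "e \<notin> X"
  shows "bij_betw (insert e) {X..S - {e}} {insert e X..S}"
  using assms by (intro bij_betw_byWitness[where f' = "\<lambda>A. A - {e}"]) auto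

lemma tree_edges_between_split:
  assumes "e \<in> S" "e \<notin> X"
  shows "tree_edges_between G X S = tree_edges_between G (insert e X) S \<union> tree_edges_between G X (S - {e})"
    and "tree_edges_between G (insert e X) S \<inter> tree_edges_between G X (S - {e}) = {}"
  using atLeastAtMost_split[OF assms] by (auto simp: tree_edges_between_def)

text \<open>The ends of \<open>e\<close> are already joined inside \<open>X\<close>, so any edge set
  containing \<open>X\<close> and \<open>e\<close> has a cycle.\<close>

lemma tree_edges_between_cycle:
  assumes "ends G e = {u, w}" "(u, w) \<in> reachability (spanning_subgraph G X)" "e \<notin> X"
  shows "tree_edges_between G (insert e X) S = {}"
proof -
  have "\<not> is_tree (spanning_subgraph G Y)" if "insert e X \<subseteq> Y" for Y
    using reachable_imp_cycle[of e Y G u w] reachability_mono[of X "Y - {e}" G] assms that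
    by (auto simp: is_tree_def)
  then show ?thesis by (auto simp: tree_edges_between_def)
qed

lemma connected_spanning_subgraph_mono:
  assumes "connected_graph (spanning_subgraph G A)" "A \<subseteq> B"
  shows "connected_graph (spanning_subgraph G B)"
  using assms reachability_mono[OF assms(2), of G] by (auto simp: connected_graph_def)

lemma tree_edges_between_disconnected:
  assumes "\<not> connected_graph (spanning_subgraph G S)"
  shows "tree_edges_between G X S = {}"
  using assms connected_spanning_subgraph_mono[of G _ S]
  by (auto simp: tree_edges_between_def is_tree_def)

text \<open>Disposes of the choice operators in \<open>head\<close>: once one endpoint is fixed, the
  other is unique, for loops too.\<close>

lemma head_in_ends:
  assumes G: "finite_multigraph G" and e: "e \<in> edges G" and U: "ends G e \<inter> U \<noteq> {}"
  obtains u where "u \<in> U" "ends G e = {u, head G U e}"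
proof -
  define u where "u = (SOME u. u \<in> ends G e \<and> u \<in> U)"
  have u: "u \<in> ends G e \<and> u \<in> U"
    unfolding u_def by (rule someI_ex) (use U in blast)
  obtain a b where "ends G e = {a, b}"
    using G e by (auto simp: finite_multigraph_def)
  then have "\<exists>!w. ends G e = {u, w}"
    using u by (auto simp: doubleton_eq_iff)
  from theI'[OF this] have "ends G e = {u, head G U e}"
    by (simp add: head_def other_end_def u_def)
  with u that show ?thesis by blast
qed

section \<open>Parking functions relative to a partial state\<close>

text \<open>
  The values outside \<open>verts G - U\<close> are pinned to those of \<open>z\<close>, because the working copy keeps
  junk values on the vertices that the tree has already reached.
\<close>

definition parking_from ::
    "('v, 'e) multigraph \<Rightarrow> 'e set \<Rightarrow> 'v set \<Rightarrow> ('v \<Rightarrow> int) \<Rightarrow> ('v \<Rightarrow> int) set" where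
  "parking_from G S U z =
     {f. (\<forall>v. v \<notin> verts G - U \<longrightarrow> f v = z v) \<and> (\<forall>v\<in>verts G - U. 0 \<le> f v) \<and>
        (\<forall>A. A \<subseteq> verts G - U \<and> A \<noteq> {} \<longrightarrow>
          (\<exists>v\<in>A. f v < int (outdeg (spanning_subgraph G S) A v)))}"

text \<open>Being extensional is being pinned to the constant \<open>undefined\<close>, so the
  initial state is an instance of the relative notion.\<close>

lemma parking_functions_eq:
  "parking_functions G q = parking_from G (edges G) {q} (\<lambda>_. undefined)"
proof -
  have PiE: "f \<in> (verts G - {q}) \<rightarrow>\<^sub>E {0..} \<longleftrightarrow>
      (\<forall>v. v \<notin> verts G - {q} \<longrightarrow> f v = undefined) \<and> (\<forall>v\<in>verts G - {q}. 0 \<le> f v)"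
    for f :: "_ \<Rightarrow> int"
    unfolding PiE_def Pi_def extensional_def by auto
  have nonneg: "(\<exists>v\<in>A. 0 \<le> f v \<and> P v) \<longleftrightarrow> (\<exists>v\<in>A. P v)"
    if "f \<in> (verts G - {q}) \<rightarrow>\<^sub>E {0..}" "A \<subseteq> verts G - {q}" for A P and f :: "_ \<Rightarrow> int"
    using that unfolding PiE by blast
  show ?thesis
    unfolding parking_functions_def parking_from_def spanning_subgraph_simps
    unfolding conj_assoc[symmetric] PiE[symmetric]
    using nonneg by (intro Collect_cong conj_cong refl all_cong) simp
qed

text \<open>Since \<open>u\<close> is outside \<open>A\<close>, the removed edge can leave
  \<open>A\<close> only from \<open>h\<close>.\<close>

lemma outdeg_remove_edge:
  assumes fin: "finite S" and e: "e \<in> S" "ends G e = {u, h}"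
    and u: "u \<in> verts G - A" and v: "v \<in> A"
  shows "outdeg (spanning_subgraph G S) A v =
    outdeg (spanning_subgraph G (S - {e})) A v + (if v = h then 1 else 0)"
proof -
  define D where "D S = {e \<in> S. \<exists>w\<in>verts G - A. ends G e = {v, w}}" for S
  have "D S = (if v = h then insert e (D (S - {e})) else D (S - {e}))"
    using e u v by (auto simp: D_def doubleton_eq_iff)
  moreover have "finite (D (S - {e}))" "e \<notin> D (S - {e})"
    using fin by (simp_all add: D_def)
  ultimately have "card (D S) = card (D (S - {e})) + (if v = h then 1 else 0)"
    by simp
  then show ?thesis by (simp add: outdeg_def D_def)
qed

lemma parking_from_remove_inner:
  assumes "finite S" "e \<in> S" "ends G e = {u, h}" "u \<in> verts G" "u \<in> U" "h \<in> U"
  shows "parking_from G (S - {e}) U z = parking_from G S U z"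
proof -
  have "outdeg (spanning_subgraph G S) A v = outdeg (spanning_subgraph G (S - {e})) A v"
    if "A \<subseteq> verts G - U" "v \<in> A" for A v
  proof -
    have "u \<in> verts G - A" "v \<noteq> h" using assms(4-6) that by auto
    then show ?thesis using outdeg_remove_edge[OF assms(1-3) _ that(2)] by simp
  qed
  then show ?thesis
    unfolding parking_from_def by (intro Collect_cong conj_cong refl all_cong bex_cong) auto
qed

text \<open>Only sets containing \<open>h\<close> separate the two conditions, and for them
  \<open>h\<close> itself is a witness: \<open>e\<close> leads from \<open>h\<close> to
  \<open>u\<close> outside the set, so the outdegree at \<open>h\<close> exceeds f(h) = 0.\<close>

lemma parking_from_zero:
  assumes "finite S" "e \<in> S" "ends G e = {u, h}" "u \<in> verts G" "u \<in> U" "h \<in> verts G" "h \<notin> U"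
  shows "{f \<in> parking_from G S U z. f h = 0} = parking_from G S (insert h U) (z(h := 0))"
    (is "?L = ?R")
proof (intro set_eqI iffI)
  fix f assume "f \<in> ?L"
  then show "f \<in> ?R"
    by (auto simp: parking_from_def)
next
  fix f assume f: "f \<in> ?R"
  then have h: "f h = 0"
    by (auto simp: parking_from_def)
  have "\<exists>v\<in>A. f v < int (outdeg (spanning_subgraph G S) A v)"
    if "A \<subseteq> verts G - U" "A \<noteq> {}" for A
  proof (cases "h \<in> A")
    case True
    moreover have "u \<in> verts G - A" using assms(4,5) that by auto
    ultimately have "outdeg (spanning_subgraph G S) A h > 0"
      using outdeg_remove_edge[OF assms(1-3)] by simp
    then show ?thesis using True h by (intro bexI[of _ h]) auto
  next
    case False
    then have "A \<subseteq> verts G - insert h U" using that by auto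
    then show ?thesis using f that by (auto simp: parking_from_def)
  qed
  moreover have "f v = z v" if "v \<notin> verts G - U" for v
  proof -
    have "v \<noteq> h" "v \<notin> verts G - insert h U" using that assms(6,7) by auto
    then show ?thesis using f by (simp add: parking_from_def)
  qed
  moreover have "0 \<le> f v" if "v \<in> verts G - U" for v
    using f h that by (cases "v = h") (simp_all add: parking_from_def)
  ultimately show "f \<in> ?L"
    using h unfolding parking_from_def by blast
qed

text \<open>Deleting \<open>e\<close> lowers the outdegree at \<open>h\<close> by one for every test
  set containing \<open>h\<close>, so lowering f(h) by one preserves every parking inequality. The
  condition that f(h) is nonzero is what keeps the lowered value nonnegative.\<close>

lemma parking_from_positive:
  assumes "finite S" "e \<in> S" "ends G e = {u, h}" "u \<in> verts G" "u \<in> U" "h \<in> verts G" "h \<notin> U"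
  shows "bij_betw (\<lambda>f. f(h := f h - 1)) {f \<in> parking_from G S U z. f h \<noteq> 0}
    (parking_from G (S - {e}) U z)"
proof -
  have shift: "(f(h := f h - 1)) v < int (outdeg (spanning_subgraph G (S - {e})) A v) \<longleftrightarrow>
      f v < int (outdeg (spanning_subgraph G S) A v)"
    if "A \<subseteq> verts G - U" "v \<in> A" for f :: "_ \<Rightarrow> int" and A v
  proof -
    have "u \<in> verts G - A" using assms(4,5) that by auto
    then show ?thesis using outdeg_remove_edge[OF assms(1-3) _ that(2)] by auto
  qed
  have iff: "f(h := f h - 1) \<in> parking_from G (S - {e}) U z \<longleftrightarrow>
      f \<in> parking_from G S U z \<and> f h \<noteq> 0" (is "?l \<longleftrightarrow> ?r") for f
  proof -
    have 1: "(\<forall>A. A \<subseteq> verts G - U \<and> A \<noteq> {} \<longrightarrow>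
          (\<exists>v\<in>A. (f(h := f h - 1)) v < int (outdeg (spanning_subgraph G (S - {e})) A v))) \<longleftrightarrow>
        (\<forall>A. A \<subseteq> verts G - U \<and> A \<noteq> {} \<longrightarrow>
          (\<exists>v\<in>A. f v < int (outdeg (spanning_subgraph G S) A v)))"
      using shift by (metis (no_types, lifting))
    have 2: "(\<forall>v. v \<notin> verts G - U \<longrightarrow> (f(h := f h - 1)) v = z v) \<longleftrightarrow>
        (\<forall>v. v \<notin> verts G - U \<longrightarrow> f v = z v)"
      using assms by auto
    have 3: "(\<forall>v\<in>verts G - U. 0 \<le> (f(h := f h - 1)) v) \<longleftrightarrow>
        (\<forall>v\<in>verts G - U. 0 \<le> f v) \<and> f h \<noteq> 0"
      using assms(6,7) by (auto simp: order_less_le)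
    show ?thesis
      unfolding parking_from_def mem_Collect_eq 1 2 3 by blast
  qed
  show ?thesis
  proof (rule bij_betw_byWitness[where f' = "\<lambda>f. f(h := f h + 1)"])
    show "(\<lambda>f. f(h := f h + 1)) ` parking_from G (S - {e}) U z \<subseteq> {f \<in> parking_from G S U z. f h \<noteq> 0}"
    proof (intro image_subsetI CollectI)
      fix f assume "f \<in> parking_from G (S - {e}) U z"
      then show "f(h := f h + 1) \<in> parking_from G S U z \<and> (f(h := f h + 1)) h \<noteq> 0"
        using iff[of "f(h := f h + 1)"] by simp
    qed
  qed (use iff in auto)
qed

text \<open>Test a parking function on the set of vertices not reachable from \<open>q\<close>. If
  nonempty, it would contain a vertex of positive outdegree, hence an edge to the reachable
  part.\<close>

lemma parking_from_connected:
  assumes q: "q \<in> verts G" and U: "\<And>u. u \<in> U \<Longrightarrow> (q, u) \<in> reachability (spanning_subgraph G S)"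
    and ne: "parking_from G S U z \<noteq> {}"
  shows "connected_graph (spanning_subgraph G S)"
proof -
  let ?R = "reachability (spanning_subgraph G S)"
  have "equiv (verts G) ?R"
    using equiv_reachability[of "spanning_subgraph G S"] by simp
  then have symR: "sym ?R" and transR: "trans ?R"
    by (auto simp: equiv_def)
  obtain f where f: "f \<in> parking_from G S U z" using ne by blast
  define A where "A = verts G - ?R `` {q}"
  have "A = {}"
  proof (rule ccontr)
    assume "A \<noteq> {}"
    moreover have AU: "A \<subseteq> verts G - U" using U by (auto simp: A_def)
    ultimately obtain v where v: "v \<in> A" "f v < int (outdeg (spanning_subgraph G S) A v)"
      using f unfolding parking_from_def by blast
    have "0 \<le> f v"
      using f AU v(1) unfolding parking_from_def by blast
    with v(2) have "outdeg (spanning_subgraph G S) A v \<noteq> 0" by linarith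
    then obtain e w where "e \<in> S" "w \<in> verts G - A" "ends G e = {v, w}"
      unfolding outdeg_def by (auto simp: card_eq_0_iff)
    then have "(w, v) \<in> adjacency (spanning_subgraph G S)" "(q, w) \<in> ?R" "v \<in> verts G"
      using v by (auto simp: adjacency_def A_def insert_commute)
    then have "(q, v) \<in> ?R" by (auto simp: reachability_def)
    then show False using v by (simp add: A_def)
  qed
  then have qv: "(q, v) \<in> ?R" if "v \<in> verts G" for v
    using that by (auto simp: A_def)
  then have "(v, w) \<in> ?R" if "v \<in> verts G" "w \<in> verts G" for v w
    using that symD[OF symR, of q v] transD[OF transR, of v q w] by blast
  then show ?thesis using q by (auto simp: connected_graph_def)
qed

section \<open>Deletion and contraction\<close>

text \<open>For a forest X inside a connected S, the sum over {X..S} is the Tutte polynomial of the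
  minor: contracting an edge of X lowers the number of edges and of vertices together, so both
  exponents may be computed in G.\<close>

definition tutte_weight :: "('v, 'e) multigraph \<Rightarrow> 'e set \<Rightarrow> int poly poly" where
  "tutte_weight G A =
     (varx - 1) ^ (num_components (spanning_subgraph G A) - num_components G) *
     (vary - 1) ^ (card A + num_components (spanning_subgraph G A) - card (verts G))"

lemma tutte_poly_eq: "tutte_poly G = sum (tutte_weight G) {{}..edges G}"
  by (simp add: tutte_poly_def tutte_weight_def Pow_def atLeastAtMost_def atLeast_def atMost_def)

lemma tutte_weight_insert_reachable:
  assumes G: "finite_multigraph G" and A: "A \<subseteq> edges G" "e \<notin> A"
    and e: "ends G e = {u, w}" "(u, w) \<in> reachability (spanning_subgraph G A)"
  shows "tutte_weight G (insert e A) = (vary - 1) * tutte_weight G A"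
proof -
  have "finite A" using G A by (auto simp: finite_multigraph_def intro: finite_subset)
  \<comment> \<open>By \<open>card_verts_le\<close> the subtraction is exact, so one more edge
    raises the exponent by exactly one.\<close>
  then have "card (insert e A) + num_components (spanning_subgraph G A) - card (verts G) =
      Suc (card A + num_components (spanning_subgraph G A) - card (verts G))"
    using card_verts_le[OF G A(1)] A(2) by simp
  then show ?thesis
    using num_components_insert_reachable[OF e] by (simp add: tutte_weight_def mult_ac)
qed

lemma tutte_weight_insert_unreachable:
  assumes G: "finite_multigraph G" "connected_graph G" and A: "A \<subseteq> edges G" "e \<notin> A"
    and e: "ends G e = {u, w}" "u \<in> verts G" "w \<in> verts G"
      "(u, w) \<notin> reachability (spanning_subgraph G A)"
  shows "tutte_weight G A = (varx - 1) * tutte_weight G (insert e A)"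
proof -
  have fV: "finite (verts G)" and fA: "finite A"
    using G A by (auto simp: finite_multigraph_def intro: finite_subset)
  \<comment> \<open>Since G has one component, this makes the subtraction in the exponent of x - 1
    exact.\<close>
  have "num_components (spanning_subgraph G (insert e A)) > 0"
    using num_components_pos[of "spanning_subgraph G (insert e A)"] fV e by auto
  then obtain k where "num_components (spanning_subgraph G (insert e A)) = Suc k"
    using gr0_implies_Suc by blast
  then show ?thesis
    using num_components_insert_unreachable[OF fV e] fA A(2) num_components_connected[OF G(2)]
    by (simp add: tutte_weight_def mult_ac)
qed

context
  fixes G :: "('v, 'e) multigraph" and X S :: "'e set" and e :: 'e
  assumes G: "finite_multigraph G" "connected_graph G" and S: "S \<subseteq> edges G"
    and e: "e \<in> S" "e \<notin> X"
begin

lemma finite_between: "finite {X..S}"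
  by (rule finite_subset[of _ "Pow S"])
    (use S G(1) in \<open>auto simp: finite_multigraph_def intro: finite_subset\<close>)

lemma sum_tutte_weight_split:
  "sum (tutte_weight G) {X..S} =
     sum (tutte_weight G) {X..S - {e}} + sum (tutte_weight G) {insert e X..S}"
  using finite_between atLeastAtMost_split[OF e] by (simp add: sum.union_disjoint)

lemma sum_tutte_weight_insert:
  "sum (tutte_weight G) {insert e X..S} = (\<Sum>A\<in>{X..S - {e}}. tutte_weight G (insert e A))"
  using sum.reindex_bij_betw[OF bij_betw_insert_atLeastAtMost[OF e], of "tutte_weight G"] by simp

text \<open>The ends of \<open>e\<close> are joined in X, hence in every A of the interval. The sets
  without and with \<open>e\<close> contribute 1 + (y - 1) = y.\<close>

lemma sum_tutte_weight_loop:
  assumes "ends G e = {u, w}" "(u, w) \<in> reachability (spanning_subgraph G X)"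
  shows "sum (tutte_weight G) {X..S} = vary * sum (tutte_weight G) {X..S - {e}}"
proof -
  have "tutte_weight G (insert e A) = (vary - 1) * tutte_weight G A" if "A \<in> {X..S - {e}}" for A
    by (rule tutte_weight_insert_reachable[OF G(1) _ _ assms(1)])
      (use that S assms(2) reachability_mono[of X A G] in auto)
  then have "sum (tutte_weight G) {insert e X..S} = (vary - 1) * sum (tutte_weight G) {X..S - {e}}"
    unfolding sum_tutte_weight_insert sum_distrib_left by (intro sum.cong) auto
  then show ?thesis
    using sum_tutte_weight_split by (simp add: algebra_simps)
qed

text \<open>The ends of \<open>e\<close> are separated in S - e, hence in every A below it. The sets
  without and with \<open>e\<close> contribute (x - 1) + 1 = x.\<close>

lemma sum_tutte_weight_bridge:
  assumes "ends G e = {u, w}" "u \<in> verts G" "w \<in> verts G"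
    "(u, w) \<notin> reachability (spanning_subgraph G (S - {e}))"
  shows "sum (tutte_weight G) {X..S} = varx * sum (tutte_weight G) {insert e X..S}"
proof -
  have "tutte_weight G A = (varx - 1) * tutte_weight G (insert e A)" if "A \<in> {X..S - {e}}" for A
    by (rule tutte_weight_insert_unreachable[OF G _ _ assms(1-3)])
      (use that S assms(4) reachability_mono[of A "S - {e}" G] in auto)
  then have "sum (tutte_weight G) {X..S - {e}} = (varx - 1) * sum (tutte_weight G) {insert e X..S}"
    unfolding sum_tutte_weight_insert sum_distrib_left by (intro sum.cong) auto
  then show ?thesis
    using sum_tutte_weight_split by (simp add: algebra_simps)
qed

end

section \<open>Bridges in terms of reachability\<close>

lemma connected_remove_edge_iff:
  assumes con: "connected_graph (spanning_subgraph G S)" and e: "e \<in> S" "ends G e = {u, w}"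
    and V: "u \<in> verts G" "w \<in> verts G"
  shows "connected_graph (spanning_subgraph G (S - {e})) \<longleftrightarrow>
    (u, w) \<in> reachability (spanning_subgraph G (S - {e}))"
proof
  assume "(u, w) \<in> reachability (spanning_subgraph G (S - {e}))"
  then have "reachability (spanning_subgraph G S) = reachability (spanning_subgraph G (S - {e}))"
    using reachability_insert_reachable[OF e(2), of "S - {e}"] e(1) by (simp add: insert_absorb)
  then show "connected_graph (spanning_subgraph G (S - {e}))"
    using con by (simp add: connected_graph_def)
qed (use V in \<open>simp add: connected_graph_def\<close>)

lemma bridge_iff:
  assumes G: "finite_multigraph G" and e: "e \<in> S" "ends G e = {u, w}"
    and V: "u \<in> verts G" "w \<in> verts G"
  shows "bridge (spanning_subgraph G S) e \<longleftrightarrow>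
    (u, w) \<notin> reachability (spanning_subgraph G (S - {e}))"
proof -
  have fin: "finite (verts G)" using G by (simp add: finite_multigraph_def)
  have S: "insert e (S - {e}) = S" using e(1) by auto
  show ?thesis
  proof (cases "(u, w) \<in> reachability (spanning_subgraph G (S - {e}))")
    case True
    then show ?thesis
      using num_components_insert_reachable[OF e(2) True, unfolded S] by (simp add: bridge_def)
  next
    case False
    then show ?thesis
      using num_components_insert_unreachable[OF fin e(2) V False, unfolded S] e(1)
      by (simp add: bridge_def)
  qed
qed

section \<open>Rooted trees\<close>

lemma rooted_treeD:
  assumes "rooted_tree G q S (U, X)"
  shows "U \<subseteq> verts G" "X \<subseteq> S" "q \<in> U" "is_tree (G\<lparr>verts := U, edges := X\<rparr>)"
    and "\<And>e. e \<in> X \<Longrightarrow> ends G e \<subseteq> U"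
    and "\<And>u v. u \<in> U \<Longrightarrow> v \<in> U \<Longrightarrow> (u, v) \<in> reachability (spanning_subgraph G X)"
proof -
  let ?H = "G\<lparr>verts := U, edges := X\<rparr>"
  show U: "U \<subseteq> verts G" and "X \<subseteq> S" "q \<in> U" and t: "is_tree ?H"
    using assms by (simp_all add: rooted_tree_def tree_subgraph_def)
  show "ends G e \<subseteq> U" if "e \<in> X" for e
    using finite_multigraph_ends[of ?H e] t that by (simp add: is_tree_def)
  have "adjacency ?H \<subseteq> adjacency (spanning_subgraph G X)"
    using U by (auto simp: adjacency_def)
  from rtrancl_mono[OF this] have "reachability ?H \<subseteq> reachability (spanning_subgraph G X)"
    using U by (auto simp: reachability_def)
  then show "(u, v) \<in> reachability (spanning_subgraph G X)" if "u \<in> U" "v \<in> U" for u v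
    using t that by (auto simp: is_tree_def connected_graph_def)
qed

lemma rooted_tree_root:
  assumes "q \<in> verts G"
  shows "rooted_tree G q S ({q}, {})"
proof -
  have "\<not> is_cycle (G\<lparr>verts := {q}, edges := {}\<rparr>) vs es" for vs es
    by (auto simp: is_cycle_def)
  then show ?thesis
    using assms by (auto simp: rooted_tree_def tree_subgraph_def is_tree_def finite_multigraph_def
        connected_graph_def reachability_def)
qed

lemma rooted_tree_insert:
  assumes t: "rooted_tree G q S (U, X)" and S: "S \<subseteq> edges G" and e: "e \<in> S" "ends G e = {u, h}"
    and uh: "u \<in> U" "h \<notin> U" "h \<in> verts G"
  shows "rooted_tree G q S (insert h U, insert e X)"
  using is_tree_insert_leaf[OF rooted_treeD(4)[OF t] e(2) uh(1,2)] rooted_treeD(1-3)[OF t] S e uh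
  by (auto simp: rooted_tree_def tree_subgraph_def)

text \<open>Edges of X stay inside U, and the other edges of S do not meet U. So U is closed under
  adjacency and is everything by connectedness. Then every edge of S meets U and must lie in
  X.\<close>

lemma rooted_tree_no_candidates:
  assumes G: "finite_multigraph G" and S: "S \<subseteq> edges G" and q: "q \<in> verts G"
    and con: "connected_graph (spanning_subgraph G S)"
    and t: "rooted_tree G q S (U, X)" and none: "candidate_edges G S (U, X) = {}"
  shows "U = verts G" "X = S"
proof -
  note tD = rooted_treeD[OF t]
  have inner: "ends G e \<inter> U = {}" if "e \<in> S" "e \<notin> X" for e
    using that none by (auto simp: candidate_edges_def)
  have "v \<in> U" if "(q, v) \<in> (adjacency (spanning_subgraph G S))\<^sup>*" for v
    using that
  proof (induction rule: rtrancl_induct)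
    case base
    then show ?case by (rule tD)
  next
    case (step v w)
    then obtain e where "e \<in> S" "ends G e = {v, w}" by (auto simp: adjacency_def)
    then show ?case using step(3) inner[of e] tD(5)[of e] by auto
  qed
  then show UV: "U = verts G"
    using con q tD(1) by (auto simp: connected_graph_def reachability_def)
  have "e \<in> X" if "e \<in> S" for e
    using inner[OF that] finite_multigraph_ends[OF G, of e] S that UV by blast
  then show "X = S" using tD(2) by blast
qed

section \<open>Runs of the algorithm\<close>

text \<open>Starting the loop from an arbitrary state lets an induction speak about the rest of a
  run.\<close>

definition tgs_run ::
    "('v, 'e) multigraph \<Rightarrow> ('v, 'e) edge_choice \<Rightarrow> 'e set \<Rightarrow> 'v set \<Rightarrow> 'e set \<Rightarrow> nat \<Rightarrow> nat \<Rightarrow>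
      ('v \<Rightarrow> int) \<Rightarrow> ('v, 'e) tgs_state" where
  "tgs_run G \<sigma> S U X a b f = while (tgs_continue G \<sigma>) (tgs_step G \<sigma>)
     \<lparr>avail = S, tverts = U, tedges = X, alpha = a, beta = b, cur = f\<rparr>"

lemma tgs_run_stop:
  assumes "\<sigma> S (U, X) = None"
  shows "tgs_run G \<sigma> S U X a b f =
    \<lparr>avail = S, tverts = U, tedges = X, alpha = a, beta = b, cur = f\<rparr>"
  unfolding tgs_run_def
  by (subst while_unfold) (simp add: assms tgs_continue_def tgs_choice_def)

text \<open>\<open>while_unfold\<close> holds without a termination proof, so each step is an
  equation between runs. Termination is absorbed into the later induction, which ends at
  \<open>tgs_run_stop\<close>.\<close>

lemma tgs_run_step:
  assumes "\<sigma> S (U, X) = Some e"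
  shows "head G U e \<in> U \<Longrightarrow> tgs_run G \<sigma> S U X a b f = tgs_run G \<sigma> (S - {e}) U X a (Suc b) f"
    and "head G U e \<notin> U \<Longrightarrow> f (head G U e) = 0 \<Longrightarrow> tgs_run G \<sigma> S U X a b f =
      tgs_run G \<sigma> S (insert (head G U e) U) (insert e X)
        (if bridge (spanning_subgraph G S) e then Suc a else a) b f"
    and "head G U e \<notin> U \<Longrightarrow> f (head G U e) > 0 \<Longrightarrow> tgs_run G \<sigma> S U X a b f =
      tgs_run G \<sigma> (S - {e}) U X a b (f(head G U e := f (head G U e) - 1))"
  unfolding tgs_run_def
  by (subst while_unfold; simp add: assms tgs_continue_def tgs_choice_def tgs_step_def Let_def)+

definition run_monomial :: "('v, 'e) tgs_state \<Rightarrow> int poly poly" where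
  "run_monomial s = varx ^ alpha s * vary ^ beta s"

text \<open>
  The edge picked by \<open>\<sigma>\<close> splits the parking functions, the trees and the weights alike:
  \<open>f h = 0\<close> is contraction of \<open>e\<close>, \<open>f h > 0\<close> is its deletion.  If \<open>e\<close> is a bridge, no parking
  function falls into the deletion part.
\<close>

lemma tgs_run_enumerates_trees:
  fixes G :: "('v, 'e) multigraph"
  assumes G: "finite_multigraph G" "connected_graph G" and q: "q \<in> verts G"
    and \<sigma>: "tree_growing_sequence G q \<sigma>"
    and S: "S \<subseteq> edges G" "connected_graph (spanning_subgraph G S)"
    and t: "rooted_tree G q S (U, X)" and card: "card U = Suc (card X)"
  shows "bij_betw (\<lambda>f. tedges (tgs_run G \<sigma> S U X a b f)) (parking_from G S U z)
      (tree_edges_between G X S) \<and>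
    (\<forall>f\<in>parking_from G S U z. tverts (tgs_run G \<sigma> S U X a b f) = verts G) \<and>
    (\<Sum>f\<in>parking_from G S U z. run_monomial (tgs_run G \<sigma> S U X a b f)) =
      varx ^ a * vary ^ b * sum (tutte_weight G) {X..S}"
  using S t card
\<comment> \<open>Each step removes \<open>e\<close> from S or puts it into X, so |S - X| drops. The
  counters and the pinned values change along the run and are therefore generalized.\<close>
proof (induction "card (S - X)" arbitrary: S U X a b z rule: less_induct)
  case less
  note S = less.prems(1) and con = less.prems(2) and t = less.prems(3) and card = less.prems(4)
  note tD = rooted_treeD[OF t]
  have finE: "finite (edges G)" using G by (simp add: finite_multigraph_def)
  have finS: "finite S" using finite_subset[OF S finE] .
  have finT: "finite (tree_edges_between G Y S')" if "S' \<subseteq> S" for Y S'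
    by (rule finite_subset[of _ "Pow S'"])
      (use finite_subset[OF that finS] in \<open>auto simp: tree_edges_between_def\<close>)
  have finU: "finite U" and finX: "finite X"
    using tD(1,2) finS G by (auto simp: finite_multigraph_def intro: finite_subset)
  have choice: "if candidate_edges G S (U, X) = {} then \<sigma> S (U, X) = None
      else \<exists>e\<in>candidate_edges G S (U, X). \<sigma> S (U, X) = Some e"
    using \<sigma> S t by (simp add: tree_growing_sequence_def)
  show ?case
  proof (cases "\<sigma> S (U, X)")
    case None
    then have "candidate_edges G S (U, X) = {}"
      using choice by (auto split: if_splits)
    from rooted_tree_no_candidates[OF G(1) S q con t this]
    have UV: "U = verts G" and XS: "X = S" by auto
    \<comment> \<open>U is all of V, so every value is pinned.\<close>
    have "parking_from G S U z = {z}"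
      by (auto simp: UV parking_from_def)
    moreover have "is_tree (spanning_subgraph G S)"
      using tD(4) by (simp add: UV XS spanning_subgraph_def)
    then have "tree_edges_between G X S = {X}"
      by (auto simp: XS tree_edges_between_def)
    \<comment> \<open>X = S is connected and |V| = |X| + 1, so both exponents vanish.\<close>
    moreover have "tutte_weight G X = 1"
      using num_components_connected[OF con] num_components_connected[OF G(2)] card
      by (simp add: tutte_weight_def XS UV)
    ultimately show ?thesis
      by (simp add: tgs_run_stop[of \<sigma> S U X, OF None, unfolded UV XS] run_monomial_def UV XS bij_betw_def)
  next
    case (Some e)
    define h where "h = head G U e"
    from Some choice have "e \<in> candidate_edges G S (U, X)"
      by (auto split: if_splits)
    then have e: "e \<in> S" "e \<notin> X" "ends G e \<inter> U \<noteq> {}"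
      by (auto simp: candidate_edges_def)
    obtain u where u: "u \<in> U" "ends G e = {u, h}"
      using head_in_ends[OF G(1) _ e(3)] S e(1) unfolding h_def by blast
    have uV: "u \<in> verts G" and hV: "h \<in> verts G"
      using finite_multigraph_ends(1)[OF G(1), of e] S e(1) u(2) by auto
    note step = tgs_run_step[of \<sigma> S U X e G, OF Some, folded h_def]
    have del_t: "rooted_tree G q (S - {e}) (U, X)"
      using t e(2) by (auto simp: rooted_tree_def)
    have del_less: "card (S - {e} - X) < card (S - X)"
      by (rule psubset_card_mono) (use finS e in auto)
    have del_con: "connected_graph (spanning_subgraph G (S - {e})) \<longleftrightarrow>
        (u, h) \<in> reachability (spanning_subgraph G (S - {e}))"
      by (rule connected_remove_edge_iff[OF con e(1) u(2) uV hV])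
    \<comment> \<open>The induction hypothesis for deletion requires S - e to be connected, so it is
      available only when the ends of \<open>e\<close> stay joined there.\<close>
    have del: "bij_betw (\<lambda>f. tedges (tgs_run G \<sigma> (S - {e}) U X a b f)) (parking_from G (S - {e}) U z)
          (tree_edges_between G X (S - {e})) \<and>
        (\<forall>f\<in>parking_from G (S - {e}) U z. tverts (tgs_run G \<sigma> (S - {e}) U X a b f) = verts G) \<and>
        (\<Sum>f\<in>parking_from G (S - {e}) U z. run_monomial (tgs_run G \<sigma> (S - {e}) U X a b f)) =
          varx ^ a * vary ^ b * sum (tutte_weight G) {X..S - {e}}"
      if "(u, h) \<in> reachability (spanning_subgraph G (S - {e}))" for a b
      by (rule less.hyps[OF del_less _ _ del_t card]) (use that S del_con in auto)
    show ?thesis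
    proof (cases "h \<in> U")
      case True
      \<comment> \<open>The tree already joins \<open>u\<close> to \<open>h\<close>, so
        \<open>e\<close> is a loop of the minor.\<close>
      have uh: "(u, h) \<in> reachability (spanning_subgraph G X)"
        by (rule tD(6)[OF u(1) True])
      have "(u, h) \<in> reachability (spanning_subgraph G (S - {e}))"
        using uh reachability_mono[of X "S - {e}" G] tD(2) e(2) by auto
      note IH = del[OF this, of a "Suc b"]
      have "tree_edges_between G X S = tree_edges_between G X (S - {e})"
        using tree_edges_between_split(1)[OF e(1,2), of G] tree_edges_between_cycle[OF u(2) uh e(2), of S]
        by simp
      then show ?thesis
        using IH parking_from_remove_inner[OF finS e(1) u(2) uV u(1) True, of z]
          sum_tutte_weight_loop[OF G S e(1,2) u(2) uh]
        by (simp add: step(1)[OF True] mult_ac)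
    next
      case False
      note hyps = finS e(1) u(2) uV u(1) hV False
      define P0 where "P0 = {f \<in> parking_from G S U z. f h = 0}"
      define P1 where "P1 = {f \<in> parking_from G S U z. f h \<noteq> 0}"
      have P: "parking_from G S U z = P0 \<union> P1" and P01: "P0 \<inter> P1 = {}"
        by (auto simp: P0_def P1_def)
      let ?run = "tgs_run G \<sigma> S U X a b"
      \<comment> \<open>The value of \<open>alpha\<close> after a contraction step.\<close>
      define a' where "a' = (if bridge (spanning_subgraph G S) e then Suc a else a)"
      have P0: "P0 = parking_from G S (insert h U) (z(h := 0))"
        unfolding P0_def by (rule parking_from_zero[OF hyps])
      have run0: "?run f = tgs_run G \<sigma> S (insert h U) (insert e X) a' b f" if "f \<in> P0" for f
        using step(2)[OF False] that by (simp add: P0_def a'_def)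
      have "card (S - insert e X) < card (S - X)"
        by (rule psubset_card_mono) (use finS e in auto)
      from less.hyps[OF this S con rooted_tree_insert[OF t S e(1) u(2,1) False hV],
          where a = a' and b = b and z = "z(h := 0)", folded P0]
      have IH0: "bij_betw (\<lambda>f. tedges (?run f)) P0 (tree_edges_between G (insert e X) S)"
          "\<forall>f\<in>P0. tverts (?run f) = verts G"
          "(\<Sum>f\<in>P0. run_monomial (?run f)) =
            varx ^ a' * vary ^ b * sum (tutte_weight G) {insert e X..S}"
        using run0 card finU finX False e(2)
        by (simp_all cong: bij_betw_cong sum.cong)
      let ?dec = "\<lambda>f. f(h := f h - 1)"
      have dec: "bij_betw ?dec P1 (parking_from G (S - {e}) U z)"
        unfolding P1_def by (rule parking_from_positive[OF hyps])
      have run1: "?run f = tgs_run G \<sigma> (S - {e}) U X a b (?dec f)" if "f \<in> P1" for f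
      proof -
        have "0 \<le> f h" "f h \<noteq> 0"
          using that hV False by (simp_all add: P1_def parking_from_def)
        then show ?thesis using step(3)[OF False] by simp
      qed
      \<comment> \<open>The last equation adds the contraction term so that it covers both cases. If
        \<open>e\<close> is not a bridge, \<open>P1\<close> contributes the sum over sets without
        \<open>e\<close>. If \<open>e\<close> is a bridge, \<open>P1\<close> is empty and the extra
        x in the contraction term accounts for those sets.\<close>
      have IH1: "bij_betw (\<lambda>f. tedges (?run f)) P1 (tree_edges_between G X (S - {e})) \<and>
          (\<forall>f\<in>P1. tverts (?run f) = verts G) \<and>
          varx ^ a' * vary ^ b * sum (tutte_weight G) {insert e X..S} +
            (\<Sum>f\<in>P1. run_monomial (?run f)) =
          varx ^ a * vary ^ b * sum (tutte_weight G) {X..S}"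
      proof (cases "(u, h) \<in> reachability (spanning_subgraph G (S - {e}))")
        case True
        then have a': "a' = a"
          using bridge_iff[OF G(1) e(1) u(2) uV hV] by (simp add: a'_def)
        note IH = del[OF True, of a b]
        have "bij_betw (\<lambda>f. tedges (tgs_run G \<sigma> (S - {e}) U X a b (?dec f))) P1
            (tree_edges_between G X (S - {e}))"
          using bij_betw_trans[OF dec conjunct1[OF IH]] by (simp add: comp_def)
        then have "bij_betw (\<lambda>f. tedges (?run f)) P1 (tree_edges_between G X (S - {e}))"
          using run1 by (simp cong: bij_betw_cong)
        moreover have "tverts (?run f) = verts G" if "f \<in> P1" for f
          using IH run1[OF that] bij_betwE[OF dec] that by auto
        moreover have "(\<Sum>f\<in>P1. run_monomial (?run f)) =
            varx ^ a * vary ^ b * sum (tutte_weight G) {X..S - {e}}"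
          using sum.reindex_bij_betw[OF dec, of "\<lambda>f. run_monomial (tgs_run G \<sigma> (S - {e}) U X a b f)"]
            IH run1 by simp
        ultimately show ?thesis
          using sum_tutte_weight_split[OF G S e(1,2)] by (simp add: a' algebra_simps)
      next
        case False
        then have a': "a' = Suc a"
          using bridge_iff[OF G(1) e(1) u(2) uV hV] e(1) by (simp add: a'_def)
        have ncon: "\<not> connected_graph (spanning_subgraph G (S - {e}))"
          using del_con False by simp
        \<comment> \<open>U is reached from q through X, which lies in S - e, so a relative parking
          function would make S - e connected.\<close>
        have "parking_from G (S - {e}) U z = {}"
        proof (rule ccontr)
          assume "parking_from G (S - {e}) U z \<noteq> {}"
          moreover have "(q, v) \<in> reachability (spanning_subgraph G (S - {e}))" if "v \<in> U" for v
            using rooted_treeD(2,3,6)[OF del_t] that reachability_mono[of X "S - {e}" G] by blast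
          ultimately show False
            using parking_from_connected[OF q, of U "S - {e}" z] ncon by blast
        qed
        then have "P1 = {}"
          using dec by (simp add: bij_betw_def)
        then show ?thesis
          using sum_tutte_weight_bridge[OF G S e(1,2) u(2) uV hV False]
            tree_edges_between_disconnected[OF ncon]
          by (simp add: a' mult_ac bij_betw_def)
      qed
      \<comment> \<open>Finiteness is inherited from the sets of trees through the
        bijections.\<close>
      have "finite P0" "finite P1"
        using bij_betw_finite[OF IH0(1)] bij_betw_finite[OF conjunct1[OF IH1]] finT by auto
      then have "(\<Sum>f\<in>P0 \<union> P1. run_monomial (?run f)) =
          (\<Sum>f\<in>P0. run_monomial (?run f)) + (\<Sum>f\<in>P1. run_monomial (?run f))"
        using P01 by (rule sum.union_disjoint)
      moreover have "bij_betw (\<lambda>f. tedges (?run f)) (P0 \<union> P1)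
          (tree_edges_between G (insert e X) S \<union> tree_edges_between G X (S - {e}))"
        by (rule bij_betw_combine[OF IH0(1) conjunct1[OF IH1] tree_edges_between_split(2)[OF e(1,2)]])
      ultimately show ?thesis
        unfolding P tree_edges_between_split(1)[OF e(1,2)]
        using IH0(2,3) IH1 by (simp add: ball_Un)
    qed
  qed
qed

section \<open>Reading off coefficients, and the final assembly\<close>

lemma coeff_xy_monomial:
  "coeff_xy (varx ^ a * vary ^ b) c d = (if a = c \<and> b = d then 1 else 0)"
proof -
  have x: "varx ^ a = monom 1 a"
    by (simp add: varx_def monom_altdef)
  have y: "vary ^ b = monom (monom 1 b) 0"
    by (simp add: vary_def monom_0 monom_altdef poly_const_pow)
  show ?thesis
    by (simp add: coeff_xy_def x y mult_monom)
qed

lemma coeff_xy_sum: "coeff_xy (sum p A) a b = (\<Sum>i\<in>A. coeff_xy (p i) a b)"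
  by (simp add: coeff_xy_def coeff_sum)

lemma monomial_eq_iff: "varx ^ a * vary ^ b = varx ^ c * vary ^ d \<longleftrightarrow> a = c \<and> b = d"
  by (metis coeff_xy_monomial zero_neq_one)

theorem theorem2p2p4:
  fixes G :: "('v, 'e) multigraph" and q :: 'v and \<sigma> :: "('v, 'e) edge_choice"
  assumes "finite_multigraph G" and "connected_graph G" and "q \<in> verts G"
    and "tree_growing_sequence G q \<sigma>"
  shows "bij_betw (tgs_tree G q \<sigma>) (parking_functions G q) (spanning_trees G) \<and>
    (\<forall>a b. int (card {f \<in> parking_functions G q. tgs_monomial G q \<sigma> f = varx ^ a * vary ^ b}) =
       coeff_xy (tutte_poly G) a b)"
proof -
  let ?P = "parking_functions G q" and ?T = "tree_edges_between G {} (edges G)"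
  let ?run = "tgs_run G \<sigma> (edges G) {q} {} 0 0"
  have run: "tgs G q \<sigma> f = ?run f" for f
    by (simp add: tgs_def tgs_init_def tgs_run_def)
  have main: "bij_betw (\<lambda>f. tedges (?run f)) ?P ?T"
    "\<And>f. f \<in> ?P \<Longrightarrow> tverts (?run f) = verts G"
    "(\<Sum>f\<in>?P. run_monomial (?run f)) = tutte_poly G"
    using tgs_run_enumerates_trees[OF assms, of "edges G" "{q}" "{}" 0 0 "\<lambda>_. undefined"]
      rooted_tree_root[OF assms(3), of "edges G"] assms(2)
    by (simp_all add: parking_functions_eq[symmetric] tutte_poly_eq[symmetric])
  have "bij_betw (Pair (verts G)) ?T (spanning_trees G)"
    unfolding spanning_trees_eq by (simp add: bij_betw_def inj_on_def)
  from bij_betw_trans[OF main(1) this]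
  have "bij_betw (\<lambda>f. (verts G, tedges (?run f))) ?P (spanning_trees G)"
    by (simp add: comp_def)
  then have bij: "bij_betw (tgs_tree G q \<sigma>) ?P (spanning_trees G)"
    by (rule bij_betw_cong[THEN iffD1, rotated]) (simp add: tgs_tree_def run main(2))
  have "finite ?T"
    by (rule finite_subset[of _ "Pow (edges G)"])
      (use assms(1) in \<open>auto simp: tree_edges_between_def finite_multigraph_def\<close>)
  then have fin: "finite ?P"
    using main(1) by (simp add: bij_betw_finite)
  have "coeff_xy (tutte_poly G) a b =
      int (card {f \<in> ?P. tgs_monomial G q \<sigma> f = varx ^ a * vary ^ b})" for a b
  proof -
    \<comment> \<open>The Tutte polynomial is a sum of plain monomials, one for each parking
      function, so a coefficient counts the functions with that monomial.\<close>
    have "coeff_xy (tutte_poly G) a b = (\<Sum>f\<in>?P. coeff_xy (run_monomial (?run f)) a b)"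
      unfolding main(3)[symmetric] by (rule coeff_xy_sum)
    also have "\<dots> = (\<Sum>f\<in>?P. if tgs_monomial G q \<sigma> f = varx ^ a * vary ^ b then 1 else 0)"
      by (intro sum.cong refl)
        (simp add: run_monomial_def tgs_monomial_def run coeff_xy_monomial monomial_eq_iff)
    also have "\<dots> = int (card {f \<in> ?P. tgs_monomial G q \<sigma> f = varx ^ a * vary ^ b})"
      using fin by (simp add: sum.If_cases Int_def)
    finally show ?thesis .
  qed
  with bij show ?thesis by simp
qed

end
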